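(* $\ell(3) = 120$. That is, there is a covering system consisting of one congruence for each divisor $d$ of $120$ with $d \ge 3$ (the divisor $d$ being its modulus), and for every positive integer $m < 120$ there is no covering system consisting of one congruence for each divisor $d$ of $m$ with $d \ge 3$.
   Context: A covering system (covering) is a finite set of congruences $\{x \equiv r_i \pmod{n_i}\}$ with positive integer moduli such that every integer satisfies at least one of them. For an integer $n\ge 2$, $\ell(n)$ denotes the least positive integer such that there exists a covering whose moduli are exactly the divisors of $\ell(n)$ which are at least $n$, each used once. *)

theory Defs
  imports "HOL-Number_Theory.Cong"
begin

text \<open>A pair \<open>(r, n)\<close> stands for the congruence \<open>x \<equiv> r (mod n)\<close>.\<close>

definition covering_system :: "(int \<times> nat) set \<Rightarrow> bool" where
  "covering_system C \<longleftrightarrow>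
     finite C \<and> (\<forall>(r, n) \<in> C. n > 0) \<and> (\<forall>x::int. \<exists>(r, n) \<in> C. [x = r] (mod int n))"

definition has_divisor_covering :: "nat \<Rightarrow> nat \<Rightarrow> bool" where
  "has_divisor_covering n m \<longleftrightarrow>
     (\<exists>C. covering_system C \<and> bij_betw snd C {d. d dvd m \<and> n \<le> d})"

text \<open>If no suitable number exists, the value of \<open>LEAST\<close> is unspecified; an equation for
  \<open>ell n\<close> is informative only together with the existence of the corresponding covering.\<close>

definition ell :: "nat \<Rightarrow> nat" where
  "ell n = (LEAST m. m > 0 \<and> has_divisor_covering n m)"

end

theory Submission imports Defs begin

text \<open>The classes of the divisors \<open>d \<ge> 3\<close> of \<open>m\<close> cover at most \<open>\<Sum>d. m div d\<close> of the residues
  modulo \<open>m\<close>. For \<open>m < 120\<close> this sum reaches \<open>m\<close> only if \<open>m\<close> is one of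
  \<open>24, 36, 48, 60, 72, 84, 90, 96, 108\<close>. In these cases one translates the covering so that the class
  of a suitable divisor \<open>q\<close> is that of \<open>0\<close>, and then runs through the classes of the other divisors
  in increasing order; a branch is dead as soon as the largest classes available for the remaining
  moduli are together too small for the set that is still uncovered. A covering for
  \<open>m = 120\<close> is given explicitly.\<close>

section \<open>Coverings as residue functions on the divisors\<close>

definition divisors_from :: "int \<Rightarrow> int \<Rightarrow> int list" where
  "divisors_from n m = filter (\<lambda>d. m mod d = 0) [n..m]"

lemma set_divisors_from:
  assumes "m > 0"
  shows "set (divisors_from (int n) (int m)) = int ` {d. d dvd m \<and> n \<le> d}"
proof (intro equalityI subsetI)
  fix d assume "d \<in> set (divisors_from (int n) (int m))"
  then have d: "int n \<le> d" "d dvd int m"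
    by (auto simp: divisors_from_def)
  then obtain k where "d = int k"
    by (metis nonneg_int_cases of_nat_0_le_iff order_trans)
  with d show "d \<in> int ` {d. d dvd m \<and> n \<le> d}" by auto
next
  fix d assume "d \<in> int ` {d. d dvd m \<and> n \<le> d}"
  then show "d \<in> set (divisors_from (int n) (int m))"
    using assms by (auto simp: divisors_from_def dvd_imp_le simp flip: of_nat_mod)
qed

text \<open>Each modulus occurs exactly once, so the covering is a choice of one residue per
  divisor. This replaces the set \<open>C\<close> by a function \<open>r\<close> on integer moduli,
  the form in which counting and search are carried out.\<close>

lemma divisor_covering_residues:
  assumes "has_divisor_covering n m" "m > 0"
  obtains r where "\<And>x. \<exists>d \<in> set (divisors_from (int n) (int m)). x mod d = r d mod d"
proof -
  obtain C where C: "covering_system C" "bij_betw snd C {d. d dvd m \<and> n \<le> d}"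
    using assms(1) by (auto simp: has_divisor_covering_def)
  \<comment> \<open>The description is unique at the moduli because \<open>snd\<close> is injective
    on \<open>C\<close>; at other arguments the value of \<open>r\<close> is irrelevant.\<close>
  define r where "r d = (THE a. (a, nat d) \<in> C)" for d
  have r: "r (int k) = a" if "(a, k) \<in> C" for a k
    using that C(2) unfolding r_def bij_betw_def inj_on_def by (force intro!: the_equality)
  have "\<exists>d \<in> set (divisors_from (int n) (int m)). x mod d = r d mod d" for x
  proof -
    obtain a k where ak: "(a, k) \<in> C" "[x = a] (mod int k)"
      using C(1) unfolding covering_system_def by blast
    then have "k \<in> snd ` C" by force
    then have "int k \<in> set (divisors_from (int n) (int m))"
      using bij_betw_imp_surj_on[OF C(2)] set_divisors_from[OF assms(2)] by simp
    then show ?thesis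
      using r ak by (auto simp: cong_def)
  qed
  then show ?thesis using that by blast
qed

section \<open>Density bound\<close>

text \<open>Within a class modulo \<open>d\<close> an element is determined by its quotient by
  \<open>d\<close>. As \<open>d\<close> divides \<open>m\<close>, \<open>d * (m div d) = m\<close>,
  so the quotients stay below \<open>m div d\<close>.\<close>

lemma card_residue_class_le:
  fixes d m s :: int
  assumes "d > 0" "m \<ge> 0" "d dvd m"
  shows "int (card {x \<in> {0..<m}. x mod d = s}) \<le> m div d"
proof -
  have "card {x \<in> {0..<m}. x mod d = s} \<le> card {0..<m div d}"
  proof (rule card_inj_on_le)
    show "inj_on (\<lambda>x. x div d) {x \<in> {0..<m}. x mod d = s}"
    proof (rule inj_onI)
      fix x y assume "x \<in> {x \<in> {0..<m}. x mod d = s}" "y \<in> {x \<in> {0..<m}. x mod d = s}"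
        and "x div d = y div d"
      then show "x = y"
        using mult_div_mod_eq[of d x] mult_div_mod_eq[of d y] by simp
    qed
    show "(\<lambda>x. x div d) ` {x \<in> {0..<m}. x mod d = s} \<subseteq> {0..<m div d}"
    proof (clarsimp, intro conjI)
      fix x assume "0 \<le> x" "x < m"
      then show "0 \<le> x div d" using assms by (simp add: pos_imp_zdiv_nonneg_iff)
      have "d * (x div d) \<le> x"
        using assms pos_mod_sign[of d x] mult_div_mod_eq[of d x] by linarith
      then have "d * (x div d) < d * (m div d)"
        using \<open>x < m\<close> assms by simp
      then show "x div d < m div d" using assms(1) mult_less_cancel_left_pos by blast
    qed
  qed simp
  then show ?thesis
    using assms pos_imp_zdiv_nonneg_iff[of d m] by (simp add: le_nat_iff)
qed

lemma no_divisor_covering_by_density: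
  assumes "0 < n" "0 < m"
    and "sum_list (map (\<lambda>d. int m div d) (divisors_from (int n) (int m))) < int m"
  shows "\<not> has_divisor_covering n m"
proof
  assume "has_divisor_covering n m"
  then obtain r where r: "\<And>x. \<exists>d \<in> set (divisors_from (int n) (int m)). x mod d = r d mod d"
    using divisor_covering_residues assms(2) by blast
  let ?D = "set (divisors_from (int n) (int m))"
  have "m = card {0..<int m}" by simp
  also have "{0..<int m} = (\<Union>d \<in> ?D. {x \<in> {0..<int m}. x mod d = r d mod d})"
    using r by blast
  also have "card \<dots> \<le> (\<Sum>d \<in> ?D. card {x \<in> {0..<int m}. x mod d = r d mod d})"
    by (rule card_UN_le) simp
  finally have "int m \<le> int (\<Sum>d \<in> ?D. card {x \<in> {0..<int m}. x mod d = r d mod d})"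
    by (rule of_nat_mono)
  also have "\<dots> = (\<Sum>d \<in> ?D. int (card {x \<in> {0..<int m}. x mod d = r d mod d}))"
    by (rule of_nat_sum)
  also have "\<dots> \<le> (\<Sum>d \<in> ?D. int m div d)"
    using assms(1) by (intro sum_mono card_residue_class_le) (auto simp: divisors_from_def)
  also have "\<dots> = sum_list (map (\<lambda>d. int m div d) (divisors_from (int n) (int m)))"
    by (simp add: sum_list_distinct_conv_sum_set divisors_from_def)
  finally show False using assms(3) by simp
qed

section \<open>Branch and bound over residue classes\<close>

text \<open>The largest multiplicity of an entry. Applied to the residues modulo \<open>e\<close> of
  a list of uncovered numbers, it is the most that a single class modulo \<open>e\<close> can
  cover.\<close>

fun max_count :: "int list \<Rightarrow> int" where
  "max_count [] = 0"
| "max_count (x # xs) =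
     max (1 + int (length (filter (\<lambda>y. y = x) xs))) (max_count (filter (\<lambda>y. y \<noteq> x) xs))"

lemma length_filter_eq_le_max_count: "int (length (filter (\<lambda>y. y = s) xs)) \<le> max_count xs"
proof (induction xs rule: max_count.induct)
  case (2 x xs)
  show ?case
  proof (cases "x = s")
    case False
    then have "filter (\<lambda>y. y = s) (filter (\<lambda>y. y \<noteq> x) xs) = filter (\<lambda>y. y = s) xs"
      by (auto intro: filter_cong)
    with 2 False show ?thesis by simp
  qed simp
qed simp

text \<open>The conditional is not written as a disjunction because \<open>code_simp\<close> evaluates both operands
  of a disjunction, but only one branch of a conditional.\<close>

fun uncoverable :: "int list \<Rightarrow> int list \<Rightarrow> bool" where
  "uncoverable A [] = (A \<noteq> [])"
| "uncoverable A (d # ds) =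
     (if sum_list (map (\<lambda>e. max_count (map (\<lambda>x. x mod e) A)) (d # ds)) < int (length A) then True
      else list_all (\<lambda>r. uncoverable (filter (\<lambda>x. x mod d \<noteq> r) A) ds) [0..d - 1])"

lemma length_le_sum_max_count:
  assumes "\<forall>x \<in> set A. \<exists>d \<in> set ds. x mod d = s d"
  shows "int (length A) \<le> sum_list (map (\<lambda>d. max_count (map (\<lambda>x. x mod d) A)) ds)"
proof -
  \<comment> \<open>The assumption on \<open>ds\<close> does not pass to its tail. The induction
    therefore proves a bound free of it, with the number of elements missed by all classes as an
    extra term; the assumption then makes this term 0.\<close>
  have "int (length A) \<le> sum_list (map (\<lambda>d. max_count (map (\<lambda>x. x mod d) A)) ds)
      + int (length (filter (\<lambda>x. \<forall>d \<in> set ds. x mod d \<noteq> s d) A))"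
  proof (induction ds)
    case (Cons d ds)
    let ?B = "filter (\<lambda>x. \<forall>d \<in> set ds. x mod d \<noteq> s d) A"
    have "length ?B = length (filter (\<lambda>x. x mod d = s d) ?B) + length (filter (\<lambda>x. x mod d \<noteq> s d) ?B)"
      using sum_length_filter_compl[of "\<lambda>x. x mod d = s d" ?B] by simp
    moreover have "length (filter (\<lambda>x. x mod d = s d) ?B) \<le> length (filter (\<lambda>x. x mod d = s d) A)"
      by (induction A) auto
    moreover have "int (length (filter (\<lambda>x. x mod d = s d) A)) \<le> max_count (map (\<lambda>x. x mod d) A)"
      using length_filter_eq_le_max_count[of "s d" "map (\<lambda>x. x mod d) A"]
      by (simp add: filter_map o_def)
    moreover have "filter (\<lambda>x. x mod d \<noteq> s d) ?B
        = filter (\<lambda>x. \<forall>d \<in> set (d # ds). x mod d \<noteq> s d) A"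
      by (auto intro: filter_cong)
    ultimately show ?case using Cons.IH by simp
  qed simp
  moreover have "filter (\<lambda>x. \<forall>d \<in> set ds. x mod d \<noteq> s d) A = []"
    using assms by (auto simp: filter_empty_conv)
  ultimately show ?thesis by simp
qed

text \<open>Follow the branch of the search that \<open>s\<close> prescribes: it ends either at a
  counting bound, where \<open>length_le_sum_max_count\<close> yields a missed element, or at a
  nonempty list with no moduli left. The residues must be reduced since the search tries only
  \<open>0\<close> to \<open>d - 1\<close>.\<close>

lemma uncoverable_sound:
  assumes "uncoverable A ds" "\<forall>d \<in> set ds. 0 \<le> s d \<and> s d < d"
  shows "\<exists>x \<in> set A. \<forall>d \<in> set ds. x mod d \<noteq> s d"
  using assms
proof (induction A ds rule: uncoverable.induct)
  case (1 A)
  then show ?case by (cases A) auto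
next
  case (2 A d ds)
  show ?case
  proof (cases "sum_list (map (\<lambda>e. max_count (map (\<lambda>x. x mod e) A)) (d # ds)) < int (length A)")
    case True
    then show ?thesis using length_le_sum_max_count[of A "d # ds" s] by fastforce
  next
    case False
    have "s d \<in> set [0..d - 1]" using "2.prems"(2) by auto
    moreover from this have "uncoverable (filter (\<lambda>x. x mod d \<noteq> s d) A) ds"
      using "2.prems"(1) False by (auto simp: list_all_iff)
    ultimately have "\<exists>x \<in> set (filter (\<lambda>x. x mod d \<noteq> s d) A). \<forall>e \<in> set ds. x mod e \<noteq> s e"
      using "2.IH"[OF False, of "s d"] "2.prems"(2) by auto
    then show ?thesis by auto
  qed
qed

definition search_refutes :: "int \<Rightarrow> int \<Rightarrow> int \<Rightarrow> bool" where
  "search_refutes n m q \<longleftrightarrow>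
     uncoverable (filter (\<lambda>x. x mod q \<noteq> 0) [0..m - 1]) (filter (\<lambda>d. d \<noteq> q) (divisors_from n m))"

text \<open>Coverings are preserved by translation, so one residue of \<open>q\<close> stands for
  all of them and the search saves a factor \<open>q\<close> at the root.\<close>

lemma no_divisor_covering_by_search:
  assumes "search_refutes (int n) (int m) q" "0 < n" "0 < m"
  shows "\<not> has_divisor_covering n m"
proof
  assume "has_divisor_covering n m"
  then obtain r where r: "\<And>x. \<exists>d \<in> set (divisors_from (int n) (int m)). x mod d = r d mod d"
    using divisor_covering_residues assms(3) by blast
  \<comment> \<open>The residues of the covering translated by \<open>r q\<close>; in particular
    \<open>s q = 0\<close>.\<close>
  define s where "s d = (r d - r q) mod d" for d
  have "\<forall>d \<in> set (divisors_from (int n) (int m)). 0 \<le> s d \<and> s d < d"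
    using assms(2) by (auto simp: s_def divisors_from_def)
  then obtain x where x: "x mod q \<noteq> 0"
      "\<forall>d \<in> set (divisors_from (int n) (int m)). d \<noteq> q \<longrightarrow> x mod d \<noteq> s d"
    using uncoverable_sound[OF assms(1)[unfolded search_refutes_def], of s] by auto
  obtain d where d: "d \<in> set (divisors_from (int n) (int m))" "(x + r q) mod d = r d mod d"
    using r by blast
  then have "x mod d = s d"
    unfolding s_def by (metis add_diff_cancel_right' mod_diff_left_eq)
  \<comment> \<open>For \<open>d = q\<close> the contradiction is with
    \<open>x mod q \<noteq> 0\<close>, otherwise with the choice of \<open>x\<close> outside the
    class of \<open>d\<close>.\<close>
  with x d(1) show False by (cases "d = q") (auto simp: s_def)
qed

section \<open>The numbers below 120\<close>

lemma divisor_density_below_120: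
  "list_all (\<lambda>m. m \<in> set [24, 36, 48, 60, 72, 84, 90, 96, 108]
      \<or> sum_list (map (\<lambda>d. m div d) (divisors_from 3 m)) < m) [1..119]"
  by code_simp

text \<open>Here and below, the last argument is the divisor whose class is normalized. Replacing it
  by another divisor that is at least 3 gives an equivalent statement, so the choice affects only
  the size of the search.\<close>

lemma search_refutes_24: "search_refutes 3 24 3" by code_simp
lemma search_refutes_36: "search_refutes 3 36 3" by code_simp
lemma search_refutes_48: "search_refutes 3 48 3" by code_simp
lemma search_refutes_60: "search_refutes 3 60 6" by code_simp
lemma search_refutes_72: "search_refutes 3 72 12" by code_simp
lemma search_refutes_84: "search_refutes 3 84 4" by code_simp
lemma search_refutes_90: "search_refutes 3 90 5" by code_simp
lemma search_refutes_96: "search_refutes 3 96 3" by code_simp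
lemma search_refutes_108: "search_refutes 3 108 4" by code_simp

lemma no_divisor_covering_below_120:
  assumes "0 < m" "m < 120"
  shows "\<not> has_divisor_covering 3 m"
proof (cases "int m \<in> set [24, 36, 48, 60, 72, 84, 90, 96, 108]")
  case True
  then have "\<exists>q. search_refutes 3 (int m) q"
    using search_refutes_24 search_refutes_36 search_refutes_48 search_refutes_60 search_refutes_72
      search_refutes_84 search_refutes_90 search_refutes_96 search_refutes_108
    by (simp only: list.set insert_iff empty_iff) metis
  then show ?thesis
    using no_divisor_covering_by_search[of 3 m] assms by auto
next
  case False
  have "int m \<in> set [1..119]" using assms by auto
  with False have "sum_list (map (\<lambda>d. int m div d) (divisors_from 3 (int m))) < int m"
    using divisor_density_below_120 unfolding list_all_iff by blast
  then show ?thesis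
    using no_divisor_covering_by_density[of 3 m] assms by simp
qed

section \<open>A covering for 120\<close>

text \<open>Residues are reduced and moduli increase, so that \<open>x mod d = r\<close> tests
  membership and the list of moduli can be compared directly with
  \<open>divisors_from 3 120\<close>.\<close>

definition covering_120 :: "(int \<times> int) list" where
  "covering_120 = [(0, 3), (0, 4), (0, 5), (1, 6), (2, 8), (1, 10), (5, 12), (2, 15), (3, 20),
     (22, 24), (29, 30), (6, 40), (14, 60), (38, 120)]"

lemma covering_120_residues:
  "list_all (\<lambda>x. list_ex (\<lambda>(r, d). x mod d = r) covering_120) [0..119]"
  by code_simp

lemma moduli_covering_120: "map snd covering_120 = divisors_from 3 120"
  by code_simp

lemma has_divisor_covering_120: "has_divisor_covering 3 120"
proof -
  define C where "C = map_prod id nat ` set covering_120"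
  have moduli: "snd ` set covering_120 = int ` {d. d dvd 120 \<and> 3 \<le> d}"
    using arg_cong[OF moduli_covering_120, of set] set_divisors_from[of 120 3] by simp
  have "\<exists>(r, n) \<in> C. [x = r] (mod int n)" for x
  proof -
    \<comment> \<open>Since every modulus divides 120, it suffices to have checked one
      period.\<close>
    have "x mod 120 \<in> set [0..119]" by simp
    then obtain r d where rd: "(r, d) \<in> set covering_120" "x mod 120 mod d = r"
      using covering_120_residues unfolding list_all_iff list_ex_iff by blast
    then have "d \<in> int ` {d. d dvd 120 \<and> 3 \<le> d}"
      using moduli by force
    then obtain n where n: "d = int n" "n dvd 120" by blast
    then have "int n dvd 120" by (metis of_nat_dvd_iff of_nat_numeral)
    then have "[x = r] (mod int n)" using rd(2) n(1) by (auto simp: cong_def mod_mod_cancel)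
    moreover have "(r, n) \<in> C" using rd(1) n(1) by (force simp: C_def)
    ultimately show ?thesis by blast
  qed
  moreover have "\<forall>(r, n) \<in> C. n > 0" "inj_on snd C"
    by (simp_all add: C_def covering_120_def)
  moreover have "snd ` C = nat ` snd ` set covering_120"
    by (simp add: C_def image_image)
  then have "snd ` C = {d. d dvd 120 \<and> 3 \<le> d}"
    by (simp add: moduli image_image)
  moreover have "finite C" by (simp add: C_def)
  ultimately show ?thesis
    unfolding has_divisor_covering_def covering_system_def bij_betw_def by blast
qed

theorem theorem3:
  shows "ell 3 = 120
    \<and> has_divisor_covering 3 120
    \<and> (\<forall>m::nat. 0 < m \<and> m < 120 \<longrightarrow> \<not> has_divisor_covering 3 m)"
proof -
  have "ell 3 = 120"
    unfolding ell_def
  proof (rule Least_equality)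
    show "(0::nat) < 120 \<and> has_divisor_covering 3 120"
      using has_divisor_covering_120 by simp
    show "120 \<le> m" if "0 < m \<and> has_divisor_covering 3 m" for m
      using that no_divisor_covering_below_120 not_le_imp_less by blast
  qed
  then show ?thesis
    using has_divisor_covering_120 no_divisor_covering_below_120 by blast
qed

end
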